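(* Let $0<c\le 1$ and let $f\in\mathcal{S}^*(q_c)$. Then the pre-Schwarzian norm of $f$ satisfies $$\|P_f\|\le \frac{c(1-\alpha^2)}{2(1-c\alpha)}+\frac{(1-\alpha^2)(1-\sqrt{1-c\alpha})}{\alpha},$$ where $\alpha$ is the unique root in $(0,1)$ of the equation $$-2+4cr-(2+c^2)r^2+2cr^3-c^2r^4+(1-cr)^{3/2}(2-cr+2r^2-3cr^3)=0.$$ The inequality is sharp, i.e. equality holds for some function in $\mathcal{S}^*(q_c)$.
   Context: $\mathbb{D}=\{z\in\mathbb{C}:|z|<1\}$. $\mathcal{A}$ is the class of analytic functions $f$ on $\mathbb{D}$ with $f(0)=0$ and $f'(0)=1$. For $F,G$ analytic on $\mathbb{D}$, $F\prec G$ ($F$ is subordinate to $G$) means there is an analytic $\omega:\mathbb{D}\to\mathbb{D}$ with $\omega(0)=0$ and $F(z)=G(\omega(z))$ for all $z\in\mathbb{D}$. For $0<c\le1$, $$\mathcal{S}^*(q_c)=\left\{f\in\mathcal{A}:\frac{zf'(z)}{f(z)}\prec \sqrt{1+cz}\right\},$$ where the square root is the principal branch (value $1$ at $z=0$) and $zf'(z)/f(z)$ is understood to take the value $1$ at $z=0$. For a locally univalent analytic $f$ on $\mathbb{D}$ (i.e. $f'(z)\neq0$ for all $z\in\mathbb{D}$), $P_f(z)=f''(z)/f'(z)$ is the pre-Schwarzian derivative and $\|P_f\|=\sup_{z\in\mathbb{D}}(1-|z|^2)|P_f(z)|$ is the pre-Schwarzian norm. *)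

theory Defs
  imports "HOL-Complex_Analysis.Complex_Analysis"
begin

abbreviation unit_disc :: "complex set"
  where "unit_disc \<equiv> ball 0 1"

definition class_A :: "(complex \<Rightarrow> complex) set"
  where "class_A = {f. f holomorphic_on unit_disc \<and> f 0 = 0 \<and> deriv f 0 = 1}"

definition subordinate :: "(complex \<Rightarrow> complex) \<Rightarrow> (complex \<Rightarrow> complex) \<Rightarrow> bool"
  where "subordinate F G \<longleftrightarrow>
    F holomorphic_on unit_disc \<and> G holomorphic_on unit_disc \<and>
    (\<exists>\<omega>. \<omega> holomorphic_on unit_disc \<and> \<omega> ` unit_disc \<subseteq> unit_disc \<and> \<omega> 0 = 0 \<and>
         (\<forall>z\<in>unit_disc. F z = G (\<omega> z)))"

definition q_fun :: "real \<Rightarrow> complex \<Rightarrow> complex"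
  where "q_fun c z = csqrt (1 + of_real c * z)"

text \<open>A zero of \<open>f\<close> at some \<open>z \<noteq> 0\<close> needs no separate exclusion in the class below: there
  the quotient would have the value \<open>0\<close>, which \<open>q_fun c\<close> does not take on the disc when
  \<open>0 < c \<le> 1\<close>.\<close>

definition starlike_quotient :: "(complex \<Rightarrow> complex) \<Rightarrow> complex \<Rightarrow> complex"
  where "starlike_quotient f z = (if z = 0 then 1 else z * deriv f z / f z)"

definition class_Sq :: "real \<Rightarrow> (complex \<Rightarrow> complex) set"
  where "class_Sq c = {f \<in> class_A. subordinate (starlike_quotient f) (q_fun c)}"

definition locally_univalent :: "(complex \<Rightarrow> complex) \<Rightarrow> bool"
  where "locally_univalent f \<longleftrightarrow>
    f holomorphic_on unit_disc \<and> (\<forall>z\<in>unit_disc. deriv f z \<noteq> 0)"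

definition pre_Schwarzian :: "(complex \<Rightarrow> complex) \<Rightarrow> complex \<Rightarrow> complex"
  where "pre_Schwarzian f z = deriv (deriv f) z / deriv f z"

text \<open>The norm is extended-real-valued, so that the supremum is meaningful without a
  boundedness assumption.\<close>

definition pre_Schwarzian_norm :: "(complex \<Rightarrow> complex) \<Rightarrow> ereal"
  where "pre_Schwarzian_norm f =
    (SUP z\<in>unit_disc. ereal ((1 - (cmod z)\<^sup>2) * cmod (pre_Schwarzian f z)))"

definition root_eq :: "real \<Rightarrow> real \<Rightarrow> bool"
  where "root_eq c r \<longleftrightarrow>
    - 2 + 4 * c * r - (2 + c\<^sup>2) * r\<^sup>2 + 2 * c * r ^ 3 - c\<^sup>2 * r ^ 4
      + (1 - c * r) powr (3 / 2) * (2 - c * r + 2 * r\<^sup>2 - 3 * c * r ^ 3) = 0"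

definition norm_bound :: "real \<Rightarrow> real \<Rightarrow> real"
  where "norm_bound c \<alpha> =
    c * (1 - \<alpha>\<^sup>2) / (2 * (1 - c * \<alpha>)) + (1 - \<alpha>\<^sup>2) * (1 - sqrt (1 - c * \<alpha>)) / \<alpha>"

end

theory Submission
  imports Defs
begin

text \<open>If \<open>z f'(z)/f(z) = q(z)\<close> with \<open>q = sqrt (1 + c w)\<close> for a Schwarz function \<open>w\<close>, then
  \<open>P_f = (q - 1)/z + c w'/(2 q^2)\<close>. With \<open>t = |w(z)| \<le> |z|\<close> and \<open>s = sqrt (1 - c t)\<close>, the
  Schwarz-Pick inequality and \<open>|q - 1| \<le> c t/(1 + s)\<close> give
  \<open>(1 - |z|^2) |P_f(z)| \<le> c (1 - t^2) (1/(2 s^2) + 1/(1 + s))\<close>, a rational function of \<open>s\<close>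
  alone, with equality for \<open>w(z) = z\<close> at \<open>z = -t\<close>. In the variable \<open>s = sqrt (1 - c r)\<close> the
  equation for \<open>r\<close> becomes, up to the factor \<open>-(1 - s)^2/c^2\<close>, a polynomial equation which says that
  the derivative of this function vanishes. The polynomial changes sign exactly once, so its root
  is the maximum.\<close>

section \<open>Maximising the bound as a function of s\<close>

definition crit_poly :: "real \<Rightarrow> real \<Rightarrow> real"
  where "crit_poly c s = (1 - c\<^sup>2) * (1 + 2 * s + s\<^sup>2 + s ^ 3) - s ^ 4 * (5 * s\<^sup>2 + 3 * s ^ 3 - 3)"

text \<open>With t = (1 - s^2)/c the first factor is c (1 - t^2).\<close>

definition sqrt_bound :: "real \<Rightarrow> real \<Rightarrow> real"
  where "sqrt_bound c s = (c\<^sup>2 - (1 - s\<^sup>2)\<^sup>2) / c * (1 / (2 * s\<^sup>2) + 1 / (1 + s))"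

text \<open>Both \<open>s^3/(1 + 2 s + s^2 + s^3)\<close> and, where it is nonnegative, \<open>s (5 s^2 + 3 s^3 - 3)\<close> are
  increasing, and \<open>crit_poly c s \<le> 0\<close> says that their product is at least \<open>1 - c^2\<close>.\<close>

lemma crit_poly_sign_change:
  assumes "0 < s" "s < t" "\<bar>c\<bar> \<le> 1" "crit_poly c s \<le> 0"
  shows "crit_poly c t < 0"
proof -
  define D where "D x = 1 + 2 * x + x\<^sup>2 + x ^ 3" for x :: real
  define P where "P x = 5 * x\<^sup>2 + 3 * x ^ 3 - 3" for x :: real
  have crit: "crit_poly c x = (1 - c\<^sup>2) * D x - x ^ 4 * P x" for x
    by (simp add: crit_poly_def D_def P_def)
  have c: "0 \<le> 1 - c\<^sup>2"
    using assms(3) by (simp add: abs_square_le_1)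
  have D: "D s > 0"
    using assms(1) by (simp add: D_def add_pos_pos)
  have pw: "s\<^sup>2 < t\<^sup>2" "s ^ 3 < t ^ 3"
    using assms by (auto intro: power_strict_mono)
  have "0 \<le> s ^ 4 * P s"
    using assms(4) mult_nonneg_nonneg[OF c less_imp_le[OF D]] by (simp add: crit)
  then have P: "0 \<le> P s"
    using assms(1) by (simp add: zero_le_mult_iff)
  have Pt: "P s < P t"
    using pw by (simp add: P_def)
  \<comment> \<open>Monotonicity of s^3/D(s), freed of denominators. Expanded, it compares s^3 t^k
    with t^3 s^k for k \<le> 3, one monomial at a time.\<close>
  have "s ^ 3 * D t \<le> t ^ 3 * D s"
  proof -
    have "s ^ 3 * (t * t\<^sup>2) \<le> t ^ 3 * s ^ 3" by (simp add: power3_eq_cube power2_eq_square)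
    moreover have "s ^ 3 * t\<^sup>2 \<le> t ^ 3 * s\<^sup>2"
    proof -
      have "s\<^sup>2 * t\<^sup>2 * s \<le> s\<^sup>2 * t\<^sup>2 * t" using assms by (intro mult_left_mono) auto
      then show ?thesis by (simp add: power3_eq_cube power2_eq_square mult_ac)
    qed
    moreover have "s ^ 3 * t \<le> t ^ 3 * s"
    proof -
      have "s * t * s\<^sup>2 \<le> s * t * t\<^sup>2" using assms pw by (intro mult_left_mono) auto
      then show ?thesis by (simp add: power3_eq_cube power2_eq_square mult_ac)
    qed
    ultimately show ?thesis
      using pw by (simp add: D_def algebra_simps power3_eq_cube power2_eq_square)
  qed
  then have "(1 - c\<^sup>2) * (s ^ 3 * D t) \<le> (1 - c\<^sup>2) * (t ^ 3 * D s)"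
    using c by (rule mult_left_mono)
  also have "\<dots> = t ^ 3 * ((1 - c\<^sup>2) * D s)" by simp
  also have "\<dots> \<le> t ^ 3 * (s ^ 4 * P s)"
    using assms by (intro mult_left_mono) (auto simp: crit)
  also have "\<dots> = s ^ 3 * (t ^ 3 * (s * P s))"
    by (simp add: eval_nat_numeral)
  finally have "s ^ 3 * ((1 - c\<^sup>2) * D t) \<le> s ^ 3 * (t ^ 3 * (s * P s))"
    by (simp add: mult_ac)
  then have "(1 - c\<^sup>2) * D t \<le> t ^ 3 * (s * P s)"
    using assms(1) by simp
  also have "\<dots> < t ^ 3 * (t * P t)"
  proof -
    \<comment> \<open>P s may be 0, so this step is only weak; strictness comes from P s < P
      t.\<close>
    have "s * P s \<le> t * P s" using assms P by (intro mult_right_mono) auto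
    also have "\<dots> < t * P t" using assms Pt by simp
    finally show ?thesis using assms by simp
  qed
  finally show ?thesis
    by (simp add: crit eval_nat_numeral mult_ac)
qed

text \<open>The intermediate value theorem between s = sqrt (1 - c) and s = 1, which correspond to r
  = 1 and r = 0. The value at s = 1 is -5 c^2.\<close>

lemma crit_poly_root_exists:
  assumes "0 < c" "c \<le> 1"
  shows "\<exists>s. sqrt (1 - c) < s \<and> s < 1 \<and> crit_poly c s = 0"
proof -
  \<comment> \<open>For c = 1 the left endpoint is 0, where \<open>crit_poly\<close> vanishes, so a
    positive value is taken from an interior point instead.\<close>
  have "\<exists>a. sqrt (1 - c) \<le> a \<and> a < 1 \<and> 0 < crit_poly c a"
  proof (cases "c = 1")
    case True
    then show ?thesis
      by (intro exI[of _ "1/2"]) (simp add: crit_poly_def power2_eq_square eval_nat_numeral)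
  next
    case False
    define s where "s = sqrt (1 - c)"
    have "c < 1"
      using assms False by simp
    then have s: "0 < s" "s < 1" "s\<^sup>2 = 1 - c"
      using assms by (auto simp: s_def)
    have c: "c = 1 - s\<^sup>2" using s by simp
    \<comment> \<open>At the left endpoint c = 1 - s^2, and the polynomial splits into positive
      factors.\<close>
    have "crit_poly c s = 2 * s\<^sup>2 * c * (1 + s) * (2 * s\<^sup>2 + s + 1)"
      unfolding crit_poly_def c by algebra
    also have "\<dots> > 0"
      using s assms \<open>c < 1\<close> by (intro mult_pos_pos add_pos_pos) auto
    finally show ?thesis
      using s by (intro exI[of _ s]) (simp add: s_def)
  qed
  then obtain a where a: "sqrt (1 - c) \<le> a" "a < 1" "0 < crit_poly c a"
    by blast
  have c1: "crit_poly c 1 < 0"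
    using assms by (simp add: crit_poly_def)
  have "\<exists>x\<ge>a. x \<le> 1 \<and> crit_poly c x = 0"
  proof (rule IVT2')
    show "continuous_on {a..1} (crit_poly c)"
      unfolding crit_poly_def[abs_def] by (intro continuous_intros)
  qed (use a c1 in auto)
  then obtain x where x: "a \<le> x" "x \<le> 1" "crit_poly c x = 0" by blast
  then have "x \<noteq> a" "x \<noteq> 1" using a c1 by auto
  then show ?thesis using a x by (intro exI[of _ x]) auto
qed

lemma sqrt_bound_has_derivative:
  assumes "0 < s" "c \<noteq> 0"
  shows "(sqrt_bound c has_real_derivative crit_poly c s / (c * s ^ 3 * (1 + s)\<^sup>2)) (at s)"
proof -
  have nz: "s \<noteq> 0" "1 + s \<noteq> 0" using assms by auto
  have "(sqrt_bound c has_real_derivative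
      4 * s * (1 - s\<^sup>2) / c * (1 / (2 * s\<^sup>2) + 1 / (1 + s))
        - (c\<^sup>2 - (1 - s\<^sup>2)\<^sup>2) / c * (1 / s ^ 3 + 1 / (1 + s)\<^sup>2)) (at s)"
    unfolding sqrt_bound_def[abs_def] using nz assms
    apply (auto intro!: derivative_eq_intros simp: power2_eq_square power3_eq_cube)
    apply (simp add: divide_simps)
    apply algebra
    done
  also have "4 * s * (1 - s\<^sup>2) / c * (1 / (2 * s\<^sup>2) + 1 / (1 + s))
        - (c\<^sup>2 - (1 - s\<^sup>2)\<^sup>2) / c * (1 / s ^ 3 + 1 / (1 + s)\<^sup>2)
      = crit_poly c s / (c * s ^ 3 * (1 + s)\<^sup>2)"
    using nz assms(2) unfolding crit_poly_def
    apply (simp add: divide_simps)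
    apply algebra
    done
  finally show ?thesis .
qed

text \<open>The derivative has the sign of \<open>crit_poly\<close>, so \<open>sqrt_bound c\<close>
  rises up to s0 and falls afterwards.\<close>

lemma sqrt_bound_max:
  assumes "0 < c" "c \<le> 1" "0 < s0" "crit_poly c s0 = 0" "0 < s"
  shows "sqrt_bound c s \<le> sqrt_bound c s0"
proof (cases s s0 rule: linorder_le_cases)
  case le
  show ?thesis
  proof (rule DERIV_nonneg_imp_nondecreasing[OF le])
    fix x assume x: "s \<le> x" "x \<le> s0"
    \<comment> \<open>A negative value at some x < s0 would persist up to s0, where the value is
      0.\<close>
    have "0 \<le> crit_poly c x"
      using crit_poly_sign_change[of x s0 c] assms x by (cases "x = s0") force+
    then show "\<exists>y. (sqrt_bound c has_real_derivative y) (at x) \<and> 0 \<le> y"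
      using sqrt_bound_has_derivative[of x c] assms x
      by (intro exI[of _ "crit_poly c x / (c * x ^ 3 * (1 + x)\<^sup>2)"]) simp
  qed
next
  case ge
  show ?thesis
  proof (rule DERIV_nonpos_imp_nonincreasing[OF ge])
    fix x assume x: "s0 \<le> x" "x \<le> s"
    have "crit_poly c x \<le> 0"
      using crit_poly_sign_change[of s0 x c] assms x by (cases "x = s0") force+
    then show "\<exists>y. (sqrt_bound c has_real_derivative y) (at x) \<and> y \<le> 0"
      using sqrt_bound_has_derivative[of x c] assms x
      by (intro exI[of _ "crit_poly c x / (c * x ^ 3 * (1 + x)\<^sup>2)"])
        (simp add: divide_nonpos_nonneg)
  qed
qed

section \<open>From s back to the variable r of the root equation\<close>

lemma root_eq_iff_crit_poly:
  assumes "0 < c" "0 < r" "c * r < 1"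
  shows "root_eq c r \<longleftrightarrow> crit_poly c (sqrt (1 - c * r)) = 0"
proof -
  define s where "s = sqrt (1 - c * r)"
  have s: "0 < s" "s < 1" "s\<^sup>2 = 1 - c * r"
    using assms by (auto simp: s_def)
  have "(1 - c * r) powr (3 / 2) = s ^ 3"
  proof -
    have "(1 - c * r) powr (3 / 2) = (s powr 2) powr (3 / 2)"
      using s by simp
    also have "\<dots> = s powr 3" by (simp only: powr_powr) simp
    also have "\<dots> = s ^ 3" using s by simp
    finally show ?thesis .
  qed
  \<comment> \<open>Multiplication by c^2 clears the denominators that r = (1 - s^2)/c introduces.
    The double zero at s = 1 is the trivial solution r = 0, which r > 0 excludes.\<close>
  moreover have "c\<^sup>2 * (- 2 + 4 * c * r - (2 + c\<^sup>2) * r\<^sup>2 + 2 * c * r ^ 3 - c\<^sup>2 * r ^ 4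
      + s ^ 3 * (2 - c * r + 2 * r\<^sup>2 - 3 * c * r ^ 3)) = - ((1 - s)\<^sup>2 * crit_poly c s)"
    unfolding crit_poly_def using s(3) by algebra
  ultimately have "c\<^sup>2 * (- 2 + 4 * c * r - (2 + c\<^sup>2) * r\<^sup>2 + 2 * c * r ^ 3 - c\<^sup>2 * r ^ 4
      + (1 - c * r) powr (3 / 2) * (2 - c * r + 2 * r\<^sup>2 - 3 * c * r ^ 3)) = 0 \<longleftrightarrow> crit_poly c s = 0"
    using s by simp
  then show ?thesis
    using assms by (simp add: root_eq_def s_def)
qed

lemma norm_bound_eq_sqrt_bound:
  assumes "0 < c" "0 < r" "c * r < 1"
  shows "norm_bound c r = sqrt_bound c (sqrt (1 - c * r))"
proof -
  define s where "s = sqrt (1 - c * r)"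
  have s: "0 < s" "s < 1" "s\<^sup>2 = 1 - c * r"
    using assms by (auto simp: s_def)
  \<comment> \<open>This is c r = (1 - s)(1 + s); it removes the division by r from
    \<open>norm_bound\<close>.\<close>
  have "(1 - s) / r = c / (1 + s)"
    using s assms by (simp add: field_simps power2_eq_square)
  moreover have "norm_bound c r = c * (1 - r\<^sup>2) / (2 * s\<^sup>2) + (1 - r\<^sup>2) * ((1 - s) / r)"
    by (simp add: norm_bound_def s(3) flip: s_def)
  ultimately have "norm_bound c r = (1 - r\<^sup>2) * (c * (1 / (2 * s\<^sup>2) + 1 / (1 + s)))"
    by (simp add: algebra_simps)
  also have "1 - r\<^sup>2 = (c\<^sup>2 - (1 - s\<^sup>2)\<^sup>2) / c\<^sup>2"
    using assms by (simp add: s(3) diff_divide_distrib power_mult_distrib)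
  finally show ?thesis
    using assms by (simp add: sqrt_bound_def power2_eq_square flip: s_def)
qed

text \<open>Sending r to sqrt (1 - c r) maps (0,1) bijectively onto (sqrt (1 - c), 1), so existence
  and uniqueness are inherited from the roots of \<open>crit_poly\<close>.\<close>

lemma unique_root_eq:
  assumes "0 < c" "c \<le> 1"
  shows "\<exists>!r. r \<in> {0<..<1} \<and> root_eq c r"
proof -
  have cr: "c * r < 1" if "r < 1" "0 < r" for r
    using mult_left_le_one_le[of r c] assms that by linarith
  obtain s where s: "sqrt (1 - c) < s" "s < 1" "crit_poly c s = 0"
    using crit_poly_root_exists[OF assms] by blast
  have s0: "0 < s" using s(1) assms by (smt (verit) real_sqrt_ge_zero)
  define r where "r = (1 - s\<^sup>2) / c"
  have "1 - c < s\<^sup>2"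
    using power_strict_mono[OF s(1), of 2] assms by simp
  moreover have "s\<^sup>2 < 1" using s s0 by (simp add: abs_square_less_1)
  ultimately have r: "0 < r" "r < 1" "sqrt (1 - c * r) = s"
    using assms s0 by (auto simp: r_def)
  show ?thesis
  proof (rule ex1I[of _ r])
    show "r \<in> {0<..<1} \<and> root_eq c r"
      using r s assms cr by (simp add: root_eq_iff_crit_poly)
  next
    fix x assume x: "x \<in> {0<..<1} \<and> root_eq c x"
    define t where "t = sqrt (1 - c * x)"
    have "crit_poly c t = 0" "0 < t"
      using x assms cr[of x] by (auto simp: root_eq_iff_crit_poly t_def)
    \<comment> \<open>If there were two distinct positive roots, the value at the larger one would
      be negative.\<close>
    then have "t = s"
      using crit_poly_sign_change[of s t c] crit_poly_sign_change[of t s c] assms s s0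
      by (cases s t rule: linorder_cases) auto
    then have "sqrt (1 - c * x) = sqrt (1 - c * r)"
      using r(3) by (simp only: t_def)
    then have "1 - c * x = 1 - c * r"
      by (simp only: real_sqrt_eq_iff)
    then show "x = r" using assms by simp
  qed
qed

section \<open>The Schwarz-Pick inequality for the derivative\<close>

lemma Schwarz_Pick_deriv:
  assumes hol: "w holomorphic_on ball 0 1" and im: "w ` ball 0 1 \<subseteq> ball 0 1"
    and a: "cmod a < 1"
  shows "cmod (deriv w a) * (1 - (cmod a)\<^sup>2) \<le> 1 - (cmod (w a))\<^sup>2"
proof -
  define b where "b = w a"
  have b: "cmod b < 1" using im a by (force simp: b_def)
  have pos: "0 < 1 - (cmod a)\<^sup>2" "0 < 1 - (cmod b)\<^sup>2"
    using a b by (auto simp: abs_square_less_1)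
  \<comment> \<open>The automorphism p takes 0 to a, and m takes b to 0, so the composite g fixes 0
    and the Schwarz lemma bounds its derivative there by 1. The chain rule, with p'(0) = 1 - |a|^2
    and m'(b) = 1/(1 - |b|^2), turns this into the claim.\<close>
  define p where "p = Moebius_function 0 (- a)"
  define m where "m = Moebius_function 0 b"
  define g where "g = (\<lambda>z. m (w (p z)))"
  have p_im: "p ` ball 0 1 \<subseteq> ball 0 1" and p_hol: "p holomorphic_on ball 0 1"
    using a by (auto simp: p_def Moebius_function_norm_lt_1 intro: Moebius_function_holomorphic)
  have m_im: "cmod (m z) < 1" if "cmod z < 1" for z
    using b that by (auto simp: m_def Moebius_function_norm_lt_1)
  have m_hol: "m holomorphic_on ball 0 1"
    using b by (auto simp: m_def intro: Moebius_function_holomorphic)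
  have p0: "p 0 = a" by (simp add: p_def Moebius_function_simple)
  have hol_wp: "(\<lambda>z. w (p z)) holomorphic_on ball 0 1"
    using holomorphic_on_compose_gen[OF p_hol hol p_im] by (simp add: o_def)
  have "g holomorphic_on ball 0 1"
    using holomorphic_on_compose_gen[OF hol_wp m_hol] p_im im by (force simp: g_def o_def)
  moreover have "g 0 = 0"
    by (simp add: g_def p0 m_def b_def Moebius_function_eq_zero)
  moreover have "cmod (g z) < 1" if "cmod z < 1" for z
    unfolding g_def using p_im im that by (intro m_im) force
  ultimately have le: "cmod (deriv g 0) \<le> 1"
    by (intro Schwarz_Lemma(2)[of g 0]) auto
  have dp: "(p has_field_derivative of_real (1 - (cmod a)\<^sup>2)) (at 0)"
    unfolding p_def Moebius_function_simple[abs_def]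
    by (auto intro!: derivative_eq_intros simp: complex_norm_square mult.commute simp del: of_real_power)
  have dw: "(w has_field_derivative deriv w a) (at (p 0))"
    using hol a by (simp add: p0 holomorphic_derivI[where S = "ball 0 1"])
  have dm: "(m has_field_derivative 1 / of_real (1 - (cmod b)\<^sup>2)) (at (w (p 0)))"
  proof -
    have e: "1 - cnj b * b = of_real (1 - (cmod b)\<^sup>2)"
      by (simp add: complex_norm_square mult.commute del: of_real_power)
    then have nz: "1 - cnj b * b \<noteq> 0" using pos by (simp only: e of_real_eq_0_iff)
    have "(m has_field_derivative 1 / (1 - cnj b * b)) (at b)"
      unfolding m_def Moebius_function_simple[abs_def] using nz
      by (auto intro!: derivative_eq_intros)
    then show ?thesis by (simp add: p0 b_def[symmetric] e del: of_real_diff)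
  qed
  have "(g has_field_derivative
      1 / of_real (1 - (cmod b)\<^sup>2) * (deriv w a * of_real (1 - (cmod a)\<^sup>2))) (at 0)"
    unfolding g_def using DERIV_chain2[OF dm DERIV_chain2[OF dw dp]] by simp
  then have "cmod (1 / of_real (1 - (cmod b)\<^sup>2) * (deriv w a * of_real (1 - (cmod a)\<^sup>2))) \<le> 1"
    using le DERIV_imp_deriv by metis
  then show ?thesis
    using pos by (simp add: norm_mult norm_divide b_def[symmetric] divide_simps del: of_real_diff)
qed

section \<open>Estimates for the principal square root of 1 + w\<close>

lemma Re_csqrt_one_plus_ge:
  assumes "cmod w \<le> 1"
  shows "sqrt (1 - cmod w) \<le> Re (csqrt (1 + w))"
proof -
  \<comment> \<open>The real part of the root of u is sqrt ((|u| + Re u)/2), and for u = 1 + w both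
    terms are at least 1 - |w|.\<close>
  have "1 - cmod w \<le> cmod (1 + w)" "- cmod w \<le> Re w"
    using norm_triangle_ineq2[of 1 "- w"] abs_Re_le_cmod[of w] by auto
  then show ?thesis by simp
qed

lemma one_plus_notin_nonpos_Reals:
  assumes "cmod w < 1"
  shows "1 + w \<notin> \<real>\<^sub>\<le>\<^sub>0"
  using abs_Re_le_cmod[of w] assms by (auto simp: complex_nonpos_Reals_iff)

text \<open>Since (q - 1)(q + 1) = w for the root q, it is enough to bound |q + 1| from below, which
  its real part does. Equality holds for w in [-1, 0].\<close>

lemma cmod_csqrt_one_plus_diff:
  assumes "cmod w \<le> 1"
  shows "cmod (csqrt (1 + w) - 1) \<le> cmod w / (1 + sqrt (1 - cmod w))"
proof -
  define q where "q = csqrt (1 + w)"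
  have "1 + sqrt (1 - cmod w) \<le> Re (q + 1)"
    using Re_csqrt_one_plus_ge[OF assms] by (simp add: q_def del: csqrt.sel)
  also have "\<dots> \<le> cmod (q + 1)" by (rule complex_Re_le_cmod)
  finally have le: "1 + sqrt (1 - cmod w) \<le> cmod (q + 1)" .
  have "(q - 1) * (q + 1) = w"
    using power2_csqrt[of "1 + w"] by (simp add: q_def algebra_simps power2_eq_square)
  then have "cmod (q - 1) * cmod (q + 1) = cmod w" by (metis norm_mult)
  then have "cmod (q - 1) * (1 + sqrt (1 - cmod w)) \<le> cmod w"
    using mult_left_mono[OF le norm_ge_zero[of "q - 1"]] by simp
  moreover have "0 < 1 + sqrt (1 - cmod w)"
    using assms real_sqrt_ge_zero[of "1 - cmod w"] by linarith
  ultimately show ?thesis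
    by (simp add: q_def pos_le_divide_eq)
qed

lemma cmod_scaled_less_one:
  assumes "0 < c" "c \<le> 1" "cmod z < 1"
  shows "cmod (of_real c * z) < 1"
  using assms mult_le_one[of c "cmod z"] mult_left_le_one_le[of "cmod z" c]
  by (simp add: norm_mult)

lemma has_field_derivative_csqrt_one_plus:
  assumes "cmod (of_real c * w z) < 1" "(w has_field_derivative w') (at z)"
  shows "((\<lambda>z. csqrt (1 + of_real c * w z)) has_field_derivative
            of_real c * w' / (2 * csqrt (1 + of_real c * w z))) (at z)"
  using one_plus_notin_nonpos_Reals[OF assms(1)] assms(2)
  by (auto intro!: derivative_eq_intros)

lemma csqrt_one_plus_nonzero:
  assumes "cmod w < 1"
  shows "csqrt (1 + w) \<noteq> 0"
  using one_plus_notin_nonpos_Reals[OF assms] by auto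

section \<open>From the subordination to the upper bound on the norm\<close>

lemma starlike_quotient_eq_q_fun:
  assumes "f 0 = 0" "cmod (of_real c * v) < 1" "starlike_quotient f z = q_fun c v"
  shows "z * deriv f z = f z * csqrt (1 + of_real c * v)"
proof (cases "z = 0")
  case False
  then have eq: "z * deriv f z / f z = csqrt (1 + of_real c * v)"
    using assms(3) by (simp add: starlike_quotient_def q_fun_def)
  \<comment> \<open>At a zero of f the convention x / 0 = 0 would make the quotient 0, but the root
    is nonzero.\<close>
  then have "f z \<noteq> 0"
    using csqrt_one_plus_nonzero[OF assms(2)] by auto
  with eq show ?thesis by (simp add: field_simps)
qed (use assms in simp)

text \<open>Obtained by differentiating \<open>z f'(z) = f(z) q(z)\<close> with \<open>q = csqrt (1 + c w)\<close>.\<close>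

lemma pre_Schwarzian_formula:
  assumes c: "0 < c" "c \<le> 1" and f: "f holomorphic_on unit_disc"
    and w: "w holomorphic_on unit_disc" "w ` unit_disc \<subseteq> unit_disc"
    and eq: "\<And>z. z \<in> unit_disc \<Longrightarrow> z * deriv f z = f z * csqrt (1 + of_real c * w z)"
    and z: "z \<in> unit_disc" "z \<noteq> 0" and nz: "deriv f z \<noteq> 0"
  shows "pre_Schwarzian f z = (csqrt (1 + of_real c * w z) - 1) / z
           + of_real c * deriv w z / (2 * (1 + of_real c * w z))"
proof -
  define q where "q = csqrt (1 + of_real c * w z)"
  have cw: "cmod (of_real c * w z) < 1"
    using cmod_scaled_less_one[OF c] w(2) z(1) by force
  have q: "q \<noteq> 0" "q\<^sup>2 = 1 + of_real c * w z"
    using csqrt_one_plus_nonzero[OF cw] by (auto simp: q_def)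
  have f': "deriv f holomorphic_on unit_disc"
    using f by (rule holomorphic_deriv) auto
  have d: "(f has_field_derivative deriv f z) (at z)"
    "(w has_field_derivative deriv w z) (at z)"
    "(deriv f has_field_derivative deriv (deriv f) z) (at z)"
    using holomorphic_derivI[OF f _ z(1)] holomorphic_derivI[OF w(1) _ z(1)]
      holomorphic_derivI[OF f' _ z(1)] by auto
  have "((\<lambda>z. z * deriv f z) has_field_derivative deriv f z + z * deriv (deriv f) z) (at z)"
    using d by (auto intro!: derivative_eq_intros)
  then have 1: "((\<lambda>z. f z * csqrt (1 + of_real c * w z)) has_field_derivative
      deriv f z + z * deriv (deriv f) z) (at z)"
    by (rule has_field_derivative_transform_within_open[of _ _ _ unit_disc]) (use z eq in auto)
  have 2: "((\<lambda>z. f z * csqrt (1 + of_real c * w z)) has_field_derivative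
      deriv f z * q + of_real c * deriv w z / (2 * q) * f z) (at z)"
    unfolding q_def by (rule DERIV_mult[OF d(1) has_field_derivative_csqrt_one_plus[OF cw d(2)]])
  have e: "deriv f z + z * deriv (deriv f) z = deriv f z * q + of_real c * deriv w z / (2 * q) * f z"
    by (rule DERIV_unique[OF 1 2])
  \<comment> \<open>Eliminating f leaves f' as a common factor, which cancels in f''/f'.\<close>
  have fz: "f z = z * deriv f z / q"
    using eq[OF z(1)] q by (simp add: q_def)
  have e': "z * deriv (deriv f) z = deriv f z * ((q - 1) + z * (of_real c * deriv w z / (2 * q\<^sup>2)))"
  proof -
    have "z * deriv (deriv f) z = deriv f z * q + of_real c * deriv w z / (2 * q) * f z - deriv f z"
      using e by (simp add: algebra_simps)
    then show ?thesis
      unfolding fz by (simp add: algebra_simps power2_eq_square)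
  qed
  have "pre_Schwarzian f z = z * deriv (deriv f) z / (z * deriv f z)"
    using z by (simp add: pre_Schwarzian_def)
  also have "\<dots> = (q - 1) / z + of_real c * deriv w z / (2 * q\<^sup>2)"
    unfolding e' using z nz q(1) by (simp add: field_simps)
  finally show ?thesis by (simp add: q(2)) (simp add: q_def)
qed

text \<open>The triangle inequality separates the summands, and each is bounded by a multiple of the
  same factor 1 - t^2: the first since t \<le> |z|, the second by Schwarz-Pick.\<close>

lemma pre_Schwarzian_pointwise_bound:
  assumes c: "0 < c" "c \<le> 1"
    and w: "w holomorphic_on unit_disc" "w ` unit_disc \<subseteq> unit_disc" "w 0 = 0"
    and z: "z \<in> unit_disc" "z \<noteq> 0"
  shows "(1 - (cmod z)\<^sup>2) * cmod ((csqrt (1 + of_real c * w z) - 1) / z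
           + of_real c * deriv w z / (2 * (1 + of_real c * w z)))
         \<le> sqrt_bound c (sqrt (1 - c * cmod (w z)))"
proof -
  define t where "t = cmod (w z)"
  define r where "r = cmod z"
  define s where "s = sqrt (1 - c * t)"
  have wn: "cmod (w x) < 1" if "cmod x < 1" for x using w(2) that by force
  have r: "0 < r" "r < 1" using z by (auto simp: r_def)
  have t: "0 \<le> t" "t \<le> r"
    using Schwarz_Lemma(1)[OF w(1,3) wn, of z] z by (auto simp: t_def r_def)
  have ct: "c * t < 1" "cmod (of_real c * w z) < 1"
    using cmod_scaled_less_one[OF c wn[of z]] z c by (auto simp: t_def norm_mult)
  have s: "0 < s" "s\<^sup>2 = 1 - c * t" using ct by (auto simp: s_def)
  have t2: "0 < 1 - r\<^sup>2" "1 - r\<^sup>2 \<le> 1 - t\<^sup>2"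
    using r t by (auto simp: abs_square_less_1)
  have A: "(1 - r\<^sup>2) * cmod ((csqrt (1 + of_real c * w z) - 1) / z) \<le> (1 - t\<^sup>2) * (c / (1 + s))"
  proof -
    have "cmod (csqrt (1 + of_real c * w z) - 1) \<le> c * t / (1 + s)"
      using cmod_csqrt_one_plus_diff[OF less_imp_le[OF ct(2)]] c
      by (simp add: norm_mult t_def s_def)
    \<comment> \<open>The Schwarz lemma t \<le> r compensates the division by z.\<close>
    also have "\<dots> \<le> c * r / (1 + s)"
      using t c s by (simp add: divide_right_mono)
    finally have "cmod ((csqrt (1 + of_real c * w z) - 1) / z) \<le> c / (1 + s)"
      using r s(1) by (simp add: norm_divide field_simps flip: r_def)
    then show ?thesis
      using t2 by (intro mult_mono) auto
  qed
  have B: "(1 - r\<^sup>2) * cmod (of_real c * deriv w z / (2 * (1 + of_real c * w z)))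
      \<le> (1 - t\<^sup>2) * (c / (2 * s\<^sup>2))"
  proof -
    have "cmod (deriv w z) * (1 - r\<^sup>2) \<le> 1 - t\<^sup>2"
      using Schwarz_Pick_deriv[OF w(1,2), of z] z by (simp add: r_def t_def)
    moreover have "s\<^sup>2 \<le> cmod (1 + of_real c * w z)"
      using norm_triangle_ineq2[of 1 "- (of_real c * w z)"] c by (simp add: s norm_mult t_def)
    ultimately have "c * (cmod (deriv w z) * (1 - r\<^sup>2)) / (2 * cmod (1 + of_real c * w z))
        \<le> c * (1 - t\<^sup>2) / (2 * s\<^sup>2)"
      using c s ct(1) t2 by (intro frac_le mult_left_mono) auto
    moreover have "cmod (of_real c * deriv w z / (2 * (1 + of_real c * w z)))
        = c * cmod (deriv w z) / (2 * cmod (1 + of_real c * w z))"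
      using c by (simp only: norm_mult norm_divide norm_of_real norm_numeral abs_of_pos)
    ultimately show ?thesis
      by (simp add: mult_ac)
  qed
  have factor: "(c\<^sup>2 - (1 - s\<^sup>2)\<^sup>2) / c = (1 - t\<^sup>2) * c"
  proof -
    have "1 - s\<^sup>2 = c * t" using s(2) by simp
    then have "(c\<^sup>2 - (1 - s\<^sup>2)\<^sup>2) / c = (c\<^sup>2 - (c * t)\<^sup>2) / c"
      by (simp only:)
    also have "\<dots> = (1 - t\<^sup>2) * c"
      using c by (simp add: field_simps power2_eq_square)
    finally show ?thesis .
  qed
  have bound_eq: "sqrt_bound c s = (1 - t\<^sup>2) * (c / (1 + s)) + (1 - t\<^sup>2) * (c / (2 * s\<^sup>2))"
    unfolding sqrt_bound_def factor by (simp add: algebra_simps)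
  let ?A = "(csqrt (1 + of_real c * w z) - 1) / z"
  let ?B = "of_real c * deriv w z / (2 * (1 + of_real c * w z))"
  have "(1 - r\<^sup>2) * cmod (?A + ?B) \<le> (1 - r\<^sup>2) * (cmod ?A + cmod ?B)"
    using t2 by (intro mult_left_mono norm_triangle_ineq) simp
  also have "\<dots> = (1 - r\<^sup>2) * cmod ?A + (1 - r\<^sup>2) * cmod ?B"
    by (rule distrib_left)
  also have "\<dots> \<le> sqrt_bound c s"
    unfolding bound_eq using A B by (rule add_mono)
  finally show ?thesis
    by (simp only: r_def s_def t_def)
qed

text \<open>A zero of f' at z \<noteq> 0 would make the quotient 0, a value that
  \<open>q_fun c\<close> omits on the disc; at 0 the normalisation applies.\<close>

lemma class_Sq_locally_univalent:
  assumes "0 < c" "c \<le> 1" "f \<in> class_Sq c"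
  shows "locally_univalent f"
proof -
  from assms(3) obtain w where f: "f holomorphic_on unit_disc" "deriv f 0 = 1"
    and w: "w ` unit_disc \<subseteq> unit_disc"
    and eq: "\<And>z. z \<in> unit_disc \<Longrightarrow> starlike_quotient f z = q_fun c (w z)"
    by (auto simp: class_Sq_def class_A_def subordinate_def)
  have "deriv f z \<noteq> 0" if z: "z \<in> unit_disc" for z
  proof (cases "z = 0")
    case False
    have "starlike_quotient f z \<noteq> 0"
      unfolding eq[OF z] q_fun_def using cmod_scaled_less_one[OF assms(1,2)] w z
      by (intro csqrt_one_plus_nonzero) force
    then show ?thesis using False by (auto simp: starlike_quotient_def)
  qed (use f in simp)
  then show ?thesis using f by (simp add: locally_univalent_def)
qed

text \<open>The pointwise bound depends on z only through sqrt (1 - c |w z|), so the maximum over s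
  covers every z \<noteq> 0.\<close>

lemma pre_Schwarzian_norm_le_sqrt_bound:
  assumes c: "0 < c" "c \<le> 1" and f: "f \<in> class_Sq c"
    and s0: "0 < s0" "crit_poly c s0 = 0"
  shows "pre_Schwarzian_norm f \<le> ereal (sqrt_bound c s0)"
proof -
  from f obtain w where fh: "f holomorphic_on unit_disc" "f 0 = 0"
    and w: "w holomorphic_on unit_disc" "w ` unit_disc \<subseteq> unit_disc" "w 0 = 0"
    and eq: "\<And>z. z \<in> unit_disc \<Longrightarrow> starlike_quotient f z = q_fun c (w z)"
    by (auto simp: class_Sq_def class_A_def subordinate_def)
  have nz: "deriv f z \<noteq> 0" if "z \<in> unit_disc" for z
    using class_Sq_locally_univalent[OF c f] that by (simp add: locally_univalent_def)
  have cw: "cmod (of_real c * w z) < 1" if "z \<in> unit_disc" for z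
    using cmod_scaled_less_one[OF c] w(2) that by force
  have ode: "x * deriv f x = f x * csqrt (1 + of_real c * w x)" if "x \<in> unit_disc" for x
    using fh(2) cw[OF that] eq[OF that] by (rule starlike_quotient_eq_q_fun)
  define F where "F z = (1 - (cmod z)\<^sup>2) * cmod (pre_Schwarzian f z)" for z
  have punctured: "F z \<le> sqrt_bound c s0" if z: "z \<in> unit_disc" "z \<noteq> 0" for z
  proof -
    have "pre_Schwarzian f z = (csqrt (1 + of_real c * w z) - 1) / z
        + of_real c * deriv w z / (2 * (1 + of_real c * w z))"
      using c fh(1) w(1,2) ode z nz[OF z(1)] by (rule pre_Schwarzian_formula)
    then have "F z \<le> sqrt_bound c (sqrt (1 - c * cmod (w z)))"
      unfolding F_def by (simp only: pre_Schwarzian_pointwise_bound[OF c w z])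
    also have "\<dots> \<le> sqrt_bound c s0"
      using cw[OF z(1)] c s0 by (intro sqrt_bound_max) (auto simp: norm_mult)
    finally show ?thesis .
  qed
  \<comment> \<open>The formula divides by z, so the origin is reached as a limit of the punctured
    disc, by continuity of F.\<close>
  have "F 0 \<le> sqrt_bound c s0"
  proof (rule tendsto_upperbound)
    have f': "deriv f holomorphic_on unit_disc" "deriv (deriv f) holomorphic_on unit_disc"
      using fh by (auto intro!: holomorphic_deriv)
    have "continuous_on unit_disc F"
      unfolding F_def pre_Schwarzian_def using f' nz
      by (intro continuous_intros holomorphic_on_imp_continuous_on) auto
    then show "F \<midarrow>0\<rightarrow> F 0"
      by (simp add: continuous_on_eq_continuous_at isCont_def)
    show "\<forall>\<^sub>F z in at 0. F z \<le> sqrt_bound c s0"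
      unfolding eventually_at using punctured by (intro exI[of _ 1]) (auto simp: dist_norm)
  qed auto
  then have "F z \<le> sqrt_bound c s0" if "z \<in> unit_disc" for z
    using punctured[OF that] by (cases "z = 0") auto
  then show ?thesis
    unfolding pre_Schwarzian_norm_def F_def by (intro SUP_least) simp
qed

section \<open>The extremal function\<close>

lemma q_fun_holomorphic:
  assumes "0 < c" "c \<le> 1"
  shows "q_fun c holomorphic_on unit_disc"
  unfolding q_fun_def
  using one_plus_notin_nonpos_Reals[OF cmod_scaled_less_one[OF assms]]
  by (intro holomorphic_intros) auto

text \<open>The function is \<open>f(z) = z exp(g(z))\<close> with \<open>g' = (q_c - 1)/z\<close>; writing \<open>g' = c / (1 + q_c)\<close>
  removes the singularity at \<open>0\<close>.\<close>

lemma extremal_function_exists: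
  assumes c: "0 < c" "c \<le> 1"
  obtains f where "f \<in> class_A" "\<And>z. z \<in> unit_disc \<Longrightarrow> starlike_quotient f z = q_fun c z"
proof -
  define k where "k z = of_real c / (1 + q_fun c z)" for z
  \<comment> \<open>The principal root has nonnegative real part, hence never equals -1, and k has
    no poles.\<close>
  have Re: "0 \<le> Re (q_fun c z)" for z
    unfolding q_fun_def by (rule Re_csqrt)
  have ne: "1 + q_fun c z \<noteq> 0" for z
    using Re[of z] by (auto simp: complex_eq_iff)
  have "k holomorphic_on unit_disc"
    unfolding k_def using ne by (intro holomorphic_intros q_fun_holomorphic c) auto
  then obtain g0 where "\<And>x. x \<in> unit_disc \<Longrightarrow> (g0 has_field_derivative k x) (at x within unit_disc)"
    using holomorphic_convex_primitive'[of unit_disc k] by auto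
  then have g0: "(g0 has_field_derivative k x) (at x)" if "x \<in> unit_disc" for x
    using that at_within_open[of x unit_disc] by (metis open_ball)
  \<comment> \<open>The shift makes g 0 = 0, which yields f'(0) = 1.\<close>
  define g where "g z = g0 z - g0 0" for z
  have g: "(g has_field_derivative k x) (at x)" if "x \<in> unit_disc" for x
    unfolding g_def using g0[OF that] by (auto intro!: derivative_eq_intros)
  define f where "f z = z * exp (g z)" for z
  have zk: "z * k z = q_fun c z - 1" for z
  proof -
    have "(q_fun c z - 1) * (1 + q_fun c z) = of_real c * z"
      using power2_csqrt[of "1 + of_real c * z"] by (simp add: q_fun_def algebra_simps power2_eq_square)
    then show ?thesis using ne[of z] by (simp add: k_def field_simps)
  qed
  have f: "(f has_field_derivative exp (g z) * q_fun c z) (at z)" if "z \<in> unit_disc" for z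
  proof -
    have "(f has_field_derivative exp (g z) * (1 + z * k z)) (at z)"
      unfolding f_def using g[OF that] by (auto intro!: derivative_eq_intros simp: algebra_simps)
    then show ?thesis by (simp add: zk)
  qed
  show thesis
  proof
    have "f holomorphic_on unit_disc"
      using f unfolding holomorphic_on_open[OF open_ball] by blast
    moreover have "f 0 = 0" by (simp add: f_def)
    moreover have "deriv f 0 = 1"
      using DERIV_imp_deriv[OF f[of 0]] by (simp add: g_def q_fun_def)
    ultimately show "f \<in> class_A" by (simp add: class_A_def)
  next
    fix z assume z: "z \<in> unit_disc"
    show "starlike_quotient f z = q_fun c z"
      using DERIV_imp_deriv[OF f[OF z]]
      by (cases "z = 0") (auto simp: starlike_quotient_def f_def q_fun_def)
  qed
qed

text \<open>Take the Schwarz function w(z) = z and the point z = -r. There both summands of the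
  pre-Schwarzian are positive reals, so the triangle inequality is an equality and this single point
  already gives \<open>norm_bound c r\<close>.\<close>

lemma sharp_function_exists:
  assumes c: "0 < c" "c \<le> 1" and r: "0 < r" "r < 1"
  obtains f where "f \<in> class_Sq c" "ereal (norm_bound c r) \<le> pre_Schwarzian_norm f"
proof -
  obtain f where f: "f \<in> class_A" and eq: "\<And>z. z \<in> unit_disc \<Longrightarrow> starlike_quotient f z = q_fun c z"
    using extremal_function_exists[OF c] by blast
  \<comment> \<open>Agreement with \<open>q_fun c\<close> on the whole disc gives holomorphy across
    the case distinction at 0.\<close>
  have "starlike_quotient f holomorphic_on unit_disc"
    using q_fun_holomorphic[OF c] by (rule holomorphic_transform) (simp add: eq)
  then have fS: "f \<in> class_Sq c"
    using f eq q_fun_holomorphic[OF c] unfolding class_Sq_def subordinate_def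
    by (auto intro!: exI[of _ "\<lambda>z. z"] holomorphic_intros)
  have fh: "f holomorphic_on unit_disc" "f 0 = 0" using f by (auto simp: class_A_def)
  have nz: "deriv f z \<noteq> 0" if "z \<in> unit_disc" for z
    using class_Sq_locally_univalent[OF c fS] that by (simp add: locally_univalent_def)
  have ode: "x * deriv f x = f x * csqrt (1 + of_real c * x)" if "x \<in> unit_disc" for x
    using fh(2) cmod_scaled_less_one[OF c, of x] eq[OF that] that
    by (intro starlike_quotient_eq_q_fun) auto
  define s where "s = sqrt (1 - c * r)"
  have cr: "c * r < 1" using cmod_scaled_less_one[OF c, of "of_real r"] r c by (simp add: norm_mult)
  have z: "- of_real r \<in> unit_disc" "- of_real r \<noteq> (0::complex)" using r by auto
  have "csqrt (1 + of_real c * (- of_real r)) = of_real s"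
    using cr csqrt_of_real[of "1 - c * r"] by (simp add: s_def)
  then have "pre_Schwarzian f (- of_real r) =
      (of_real s - 1) / (- of_real r) + of_real c / (2 * (1 + of_real c * (- of_real r)))"
    using pre_Schwarzian_formula[OF c fh(1) _ _ _ z nz[OF z(1)], of "\<lambda>z. z"] ode
    by (simp add: holomorphic_on_ident)
  also have "\<dots> = of_real ((1 - s) / r + c / (2 * (1 - c * r)))"
    by (simp add: minus_divide_right[symmetric] minus_divide_left)
  finally have P: "cmod (pre_Schwarzian f (- of_real r)) = (1 - s) / r + c / (2 * (1 - c * r))"
    using cr r c by (simp only: norm_of_real) (simp add: s_def)
  have "norm_bound c r = (1 - (cmod (- of_real r))\<^sup>2) * cmod (pre_Schwarzian f (- of_real r))"
    unfolding P by (simp add: norm_bound_def s_def algebra_simps)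
  then have "ereal (norm_bound c r) \<le> pre_Schwarzian_norm f"
    unfolding pre_Schwarzian_norm_def
    by (metis (mono_tags, lifting) SUP_upper z(1))
  with fS show thesis by (rule that)
qed

theorem theorem2p2:
  fixes c :: real
  assumes "0 < c" and "c \<le> 1"
  shows "(\<exists>!\<alpha>. \<alpha> \<in> {0<..<1} \<and> root_eq c \<alpha>) \<and>
    (\<forall>\<alpha>. \<alpha> \<in> {0<..<1} \<and> root_eq c \<alpha> \<longrightarrow>
      (\<forall>f\<in>class_Sq c. locally_univalent f \<and>
          pre_Schwarzian_norm f \<le> ereal (norm_bound c \<alpha>)) \<and>
      (\<exists>f\<in>class_Sq c. pre_Schwarzian_norm f = ereal (norm_bound c \<alpha>)))"
proof (intro conjI allI impI)
  show "\<exists>!\<alpha>. \<alpha> \<in> {0<..<1} \<and> root_eq c \<alpha>"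
    using assms by (rule unique_root_eq)
next
  fix \<alpha> assume \<alpha>: "\<alpha> \<in> {0<..<1} \<and> root_eq c \<alpha>"
  then have c\<alpha>: "c * \<alpha> < 1"
    using cmod_scaled_less_one[OF assms, of "of_real \<alpha>"] assms by (simp add: norm_mult)
  then have "crit_poly c (sqrt (1 - c * \<alpha>)) = 0"
    using \<alpha> assms root_eq_iff_crit_poly[of c \<alpha>] by simp
  then have "pre_Schwarzian_norm f \<le> ereal (norm_bound c \<alpha>)" if "f \<in> class_Sq c" for f
    using pre_Schwarzian_norm_le_sqrt_bound[OF assms that, of "sqrt (1 - c * \<alpha>)"] \<alpha> c\<alpha> assms
    by (simp add: norm_bound_eq_sqrt_bound)
  \<comment> \<open>The lower bound at the point -\<alpha> meets the upper bound for the whole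
    class, which gives sharpness.\<close>
  moreover obtain f where "f \<in> class_Sq c" "ereal (norm_bound c \<alpha>) \<le> pre_Schwarzian_norm f"
    using sharp_function_exists[OF assms] \<alpha> by auto
  ultimately show "\<forall>f\<in>class_Sq c. locally_univalent f \<and> pre_Schwarzian_norm f \<le> ereal (norm_bound c \<alpha>)"
    and "\<exists>f\<in>class_Sq c. pre_Schwarzian_norm f = ereal (norm_bound c \<alpha>)"
    using class_Sq_locally_univalent[OF assms] by (auto intro: antisym)
qed

end
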